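(* Every cubic (i.e. $3$-regular) graph of order $10$ is matching unique.
   Context: Graphs are finite and simple; the order of a graph is its number of vertices; graphs are not assumed to be connected. A $k$-matching in a graph $G$ is a set of $k$ edges of $G$, no two of which share a vertex; $\rho(G,k)$ denotes the number of $k$-matchings of $G$, with $\rho(G,0)=1$. The matching polynomial of a graph $G$ of order $n$ is $\mu(G,x)=\sum_{k=0}^{\lfloor n/2\rfloor}(-1)^k\rho(G,k)x^{n-2k}$. A graph $G$ is matching unique if it is characterized by its matching polynomial, i.e. every graph $H$ with $\mu(H,x)=\mu(G,x)$ is isomorphic to $G$. *)

theory Defs
  imports
    "HOL-Library.Ramsey"
    "HOL-Computational_Algebra.Polynomial"
begin

datatype 'a ugraph = UGraph (verts: "'a set") (edges: "'a set set")

text \<open>An edge is a two-element set of vertices, so loops and multiple edges are excluded.\<close>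

definition simple_graph :: "'a ugraph \<Rightarrow> bool" where
  "simple_graph G \<longleftrightarrow> finite (verts G) \<and> edges G \<subseteq> nsets (verts G) 2"

definition graph_order :: "'a ugraph \<Rightarrow> nat" where
  "graph_order G = card (verts G)"

definition vdegree :: "'a ugraph \<Rightarrow> 'a \<Rightarrow> nat" where
  "vdegree G v = card {e \<in> edges G. v \<in> e}"

definition regular_graph :: "nat \<Rightarrow> 'a ugraph \<Rightarrow> bool" where
  "regular_graph r G \<longleftrightarrow> (\<forall>v \<in> verts G. vdegree G v = r)"

definition k_matchings :: "'a ugraph \<Rightarrow> nat \<Rightarrow> 'a set set set" where
  "k_matchings G k = {M. M \<subseteq> edges G \<and> card M = k \<and> pairwise disjnt M}"

definition num_matchings :: "'a ugraph \<Rightarrow> nat \<Rightarrow> nat" where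
  "num_matchings G k = card (k_matchings G k)"

text \<open>
  The set of matchings is meaningful only for finite edge sets, where \<open>card M = 0\<close> forces
  \<open>M = {}\<close>; the convention that there is exactly one empty matching is then automatic.
\<close>

lemma num_matchings_0:
  assumes "simple_graph G"
  shows "num_matchings G 0 = 1"
proof -
  have "finite (edges G)"
    using assms finite_imp_finite_nsets[of "verts G" 2]
    by (auto simp: simple_graph_def intro: finite_subset)
  then have "k_matchings G 0 = {{}}"
    by (auto simp: k_matchings_def dest: finite_subset)
  then show ?thesis by (simp add: num_matchings_def)
qed

definition matching_poly :: "'a ugraph \<Rightarrow> int poly" where
  "matching_poly G =
     (\<Sum>k = 0..graph_order G div 2. monom ((- 1) ^ k * int (num_matchings G k)) (graph_order G - 2 * k))"

definition graph_isomorphic :: "'a ugraph \<Rightarrow> 'b ugraph \<Rightarrow> bool" where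
  "graph_isomorphic G H \<longleftrightarrow>
     (\<exists>f. bij_betw f (verts G) (verts H) \<and>
       (\<forall>u \<in> verts G. \<forall>v \<in> verts G. {u, v} \<in> edges G \<longleftrightarrow> {f u, f v} \<in> edges H))"

text \<open>
  HOL cannot quantify over types inside a definition, so the vertex type of the competing graphs
  is a parameter; a statement with \<open>'b\<close> left schematic covers graphs on vertices of any type.
\<close>

definition matching_unique :: "'b itself \<Rightarrow> 'a ugraph \<Rightarrow> bool" where
  "matching_unique (_ :: 'b itself) G \<longleftrightarrow>
     (\<forall>H :: 'b ugraph. simple_graph H \<longrightarrow> matching_poly H = matching_poly G \<longrightarrow>
        graph_isomorphic H G)"

end

theory Submission
  imports Defs
begin

text \<open>
  The degree of the matching polynomial is the order of the graph, and its coefficients are the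
  numbers \<open>\<rho>\<^sub>k\<close> of \<open>k\<close>-matchings up to sign. If \<open>m = \<rho>\<^sub>1\<close> is the number of edges, then the degrees
  sum to \<open>2m\<close>, and counting pairs of edges by their intersection shows that the squares of the
  degrees sum to \<open>m\<^sup>2 + m - 2\<rho>\<^sub>2\<close>. So \<open>\<rho>\<^sub>1\<close> and \<open>\<rho>\<^sub>2\<close> determine the sum of \<open>(d(v) - 3)\<^sup>2\<close> over all
  vertices \<open>v\<close>, and a graph that shares its matching polynomial with a cubic graph is cubic
  (\<open>regular_graph_if_matching_poly_eq\<close>).

  It remains to compare two cubic graphs of order 10. Up to isomorphism there are 21 of them, and
  they have 21 different pairs \<open>(\<rho>\<^sub>4, \<rho>\<^sub>5)\<close>; hence two cubic graphs of order 10 with the same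
  matching polynomial are isomorphic to the same one of the 21.

  The classification is a case distinction on labelled edge lists, called patterns. Every cubic
  graph contains a claw. When a graph contains a pattern in which the vertex \<open>v\<close> has fewer than
  three neighbours, the missing neighbours of \<open>v\<close> are among the vertices of degree at most two that
  are not yet adjacent to \<open>v\<close>; so the graph contains one of finitely many larger patterns
  (\<open>labels_completion\<close>). Many of these contain, up to relabelling, a pattern that is treated
  elsewhere, and stating the relabelling closes the case. Since only containment of patterns is
  claimed, the relabelling only has to map edges to edges. The resulting proof tree is written
  down as the list \<open>case_table\<close>; its correctness is a finite computation (\<open>case_table_ok\<close>), and
  \<open>table_ok_sound\<close> turns this computation into the theorem that every cubic graph of order 10
  contains one of the 21 cubic patterns (\<open>contains_cubic_pattern\<close>), to which it is then isomorphic
  because no vertex has room for another edge.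
\<close>

section \<open>Matching numbers and vertex degrees\<close>

lemma finite_edges:
  assumes "simple_graph G"
  shows "finite (edges G)"
  using assms finite_imp_finite_nsets[of "verts G" 2]
  by (auto simp: simple_graph_def intro: finite_subset)

lemma edge_subset_verts: "simple_graph G \<Longrightarrow> e \<in> edges G \<Longrightarrow> e \<subseteq> verts G"
  by (auto simp: simple_graph_def nsets_def)

lemma card_edge: "simple_graph G \<Longrightarrow> e \<in> edges G \<Longrightarrow> card e = 2"
  by (auto simp: simple_graph_def nsets_def)

lemma coeff_matching_poly:
  assumes "2 * k \<le> graph_order G"
  shows "coeff (matching_poly G) (graph_order G - 2 * k) = (- 1) ^ k * int (num_matchings G k)"
proof -
  let ?n = "graph_order G"
  let ?c = "\<lambda>i. (- 1) ^ i * int (num_matchings G i)"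
  have "coeff (matching_poly G) (?n - 2 * k)
      = (\<Sum>i = 0..?n div 2. coeff (monom (?c i) (?n - 2 * i)) (?n - 2 * k))"
    by (simp add: matching_poly_def coeff_sum)
  also have "\<dots> = (\<Sum>i = 0..?n div 2. if i = k then ?c k else 0)"
    using assms by (intro sum.cong) auto
  also have "\<dots> = ?c k"
    using assms by auto
  finally show ?thesis .
qed

text \<open>The leading coefficient is the number of empty matchings, which is 1; this is why the polynomial
  knows the order of the graph.\<close>

lemma degree_matching_poly:
  assumes "simple_graph G"
  shows "degree (matching_poly G) = graph_order G"
proof (rule antisym)
  show "degree (matching_poly G) \<le> graph_order G"
    unfolding matching_poly_def
    by (intro degree_sum_le) (auto intro: order.trans[OF degree_monom_le])
  have "coeff (matching_poly G) (graph_order G) = 1"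
    using coeff_matching_poly[of 0 G] num_matchings_0[OF assms] by simp
  then show "graph_order G \<le> degree (matching_poly G)"
    by (intro le_degree) simp
qed

lemma graph_order_eq:
  assumes "simple_graph G" "simple_graph H" "matching_poly H = matching_poly G"
  shows "graph_order H = graph_order G"
  using assms degree_matching_poly by metis

lemma num_matchings_eq:
  assumes "simple_graph G" "simple_graph H" "matching_poly H = matching_poly G"
    and "2 * k \<le> graph_order G"
  shows "num_matchings H k = num_matchings G k"
  using coeff_matching_poly[of k G] coeff_matching_poly[of k H] graph_order_eq[OF assms(1-3)]
    assms(3,4) by simp

lemma num_matchings_1: "num_matchings G 1 = card (edges G)"
proof -
  have "k_matchings G 1 = (\<lambda>e. {e}) ` edges G"
    by (auto simp: k_matchings_def card_1_singleton_iff)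
  then show ?thesis
    by (simp add: num_matchings_def card_image)
qed

lemma vdegree_eq_sum:
  assumes "simple_graph G"
  shows "vdegree G v = (\<Sum>e\<in>edges G. of_bool (v \<in> e))"
  using finite_edges[OF assms] by (simp add: vdegree_def sum_of_bool_eq Collect_conj_eq)

text \<open>The degrees and their squares are sums of indicators over vertices and edges. After exchanging
  the sums, the inner sum runs over the vertices and is evaluated by this lemma.\<close>

lemma sum_vertices_of_bool:
  assumes "simple_graph G" "A \<subseteq> verts G"
  shows "(\<Sum>v\<in>verts G. of_bool (v \<in> A)) = card A"
  using assms by (simp add: sum_of_bool_eq simple_graph_def Int_absorb1)

lemma sum_vdegree:
  assumes "simple_graph G"
  shows "(\<Sum>v\<in>verts G. vdegree G v) = 2 * card (edges G)"
proof -
  have "(\<Sum>v\<in>verts G. vdegree G v) = (\<Sum>e\<in>edges G. \<Sum>v\<in>verts G. of_bool (v \<in> e))"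
    unfolding vdegree_eq_sum[OF assms] by (rule sum.swap)
  also have "\<dots> = (\<Sum>e\<in>edges G. 2)"
    using assms by (intro sum.cong) (simp_all add: sum_vertices_of_bool edge_subset_verts card_edge)
  finally show ?thesis
    by simp
qed

text \<open>Each 2-matching \<open>{e, f}\<close> comes from the two ordered pairs \<open>(e, f)\<close> and \<open>(f, e)\<close>; disjoint edges
  are distinct because edges are nonempty.\<close>

lemma card_disjoint_edge_pairs:
  assumes "simple_graph G"
  shows "card {(e, f) \<in> edges G \<times> edges G. disjnt e f} = 2 * num_matchings G 2"
proof -
  let ?S = "{(e, f) \<in> edges G \<times> edges G. disjnt e f}"
  let ?set = "\<lambda>(e, f). {e, f}"
  have fin: "finite ?S" "finite (k_matchings G 2)"
    using finite_edges[OF assms] finite_subset[of ?S "edges G \<times> edges G"]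
      finite_subset[of "k_matchings G 2" "Pow (edges G)"]
    by (auto simp: k_matchings_def)
  have ne: "e \<noteq> f" if "e \<in> edges G" "disjnt e f" for e f :: "'a set"
    using that card_edge[OF assms that(1)] by (auto simp: disjnt_def)
  have "card ?S = (\<Sum>p\<in>?S. 1)"
    by simp
  also have "\<dots> = (\<Sum>M\<in>k_matchings G 2. \<Sum>p\<in>{p \<in> ?S. ?set p = M}. 1)"
  proof (rule sum.group[symmetric, OF fin])
    show "?set ` ?S \<subseteq> k_matchings G 2"
      using ne by (auto simp: k_matchings_def pairwise_def disjnt_sym card_insert_if)
  qed
  also have "\<dots> = (\<Sum>M\<in>k_matchings G 2. 2)"
  proof (rule sum.cong[OF refl])
    fix M assume "M \<in> k_matchings G 2"
    then obtain e f where M: "M = {e, f}" "e \<noteq> f" "e \<in> edges G" "f \<in> edges G" "disjnt e f"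
      by (auto simp: k_matchings_def card_2_iff pairwise_def)
    have "{p \<in> ?S. ?set p = M} = {(e, f), (f, e)}"
      using M by (auto simp: doubleton_eq_iff disjnt_sym)
    then show "(\<Sum>p\<in>{p \<in> ?S. ?set p = M}. 1) = 2"
      using M(2) by simp
  qed
  finally show ?thesis
    by (simp add: num_matchings_def)
qed

text \<open>The square of the degree of \<open>v\<close> counts the pairs \<open>(e, f)\<close> of edges with \<open>v \<in> e \<inter> f\<close>, so the
  sum of the squares is the sum of \<open>card (e \<inter> f)\<close> over all pairs. This cardinality is 2 if \<open>e = f\<close>,
  0 if \<open>e\<close> and \<open>f\<close> are disjoint, and 1 otherwise.\<close>

lemma sum_vdegree_squared:
  assumes "simple_graph G"
  shows "(\<Sum>v\<in>verts G. (vdegree G v)\<^sup>2) + 2 * num_matchings G 2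
    = (card (edges G))\<^sup>2 + card (edges G)"
proof -
  let ?E = "edges G"
  note fin = finite_edges[OF assms]
  have "(\<Sum>v\<in>verts G. (vdegree G v)\<^sup>2)
      = (\<Sum>v\<in>verts G. \<Sum>e\<in>?E. \<Sum>f\<in>?E. of_bool (v \<in> e \<inter> f))"
    unfolding vdegree_eq_sum[OF assms] power2_eq_square sum_product
    by (intro sum.cong) auto
  also have "\<dots> = (\<Sum>e\<in>?E. \<Sum>v\<in>verts G. \<Sum>f\<in>?E. of_bool (v \<in> e \<inter> f))"
    by (rule sum.swap)
  also have "\<dots> = (\<Sum>e\<in>?E. \<Sum>f\<in>?E. \<Sum>v\<in>verts G. of_bool (v \<in> e \<inter> f))"
    by (intro sum.cong refl sum.swap)
  also have "\<dots> = (\<Sum>e\<in>?E. \<Sum>f\<in>?E. card (e \<inter> f))"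
    using assms edge_subset_verts
    by (intro sum.cong refl sum_vertices_of_bool) auto
  finally have squares: "(\<Sum>v\<in>verts G. (vdegree G v)\<^sup>2) = (\<Sum>e\<in>?E. \<Sum>f\<in>?E. card (e \<inter> f))" .
  have "card {(e, f) \<in> ?E \<times> ?E. disjnt e f} = (\<Sum>(e, f)\<in>?E \<times> ?E. of_bool (disjnt e f))"
    using fin by (auto simp: sum_of_bool_eq case_prod_unfold intro: arg_cong[where f = card])
  then have pairs: "2 * num_matchings G 2 = (\<Sum>e\<in>?E. \<Sum>f\<in>?E. of_bool (disjnt e f))"
    using card_disjoint_edge_pairs[OF assms] by (simp add: sum.cartesian_product)
  have "card (e \<inter> f) + of_bool (disjnt e f) = 1 + of_bool (e = f)"
    if e: "e \<in> ?E" and f: "f \<in> ?E" for e f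
  proof (cases "e = f")
    case True
    then show ?thesis
      using card_edge[OF assms e] by (auto simp: disjnt_def)
  next
    case False
    have fins: "finite e" "finite f"
      using card_edge[OF assms] e f by (metis card.infinite zero_neq_numeral)+
    have "card (e \<inter> f) \<noteq> 2"
      using False card_edge[OF assms e] card_edge[OF assms f] fins
      by (metis card_subset_eq inf.cobounded1 inf.cobounded2)
    moreover have "card (e \<inter> f) \<le> 2"
      using card_mono[OF fins(1), of "e \<inter> f"] card_edge[OF assms e] by simp
    moreover have "card (e \<inter> f) = 0 \<longleftrightarrow> disjnt e f"
      using fins by (simp add: disjnt_def)
    ultimately show ?thesis
      using False by (cases "disjnt e f") auto
  qed
  then have "(\<Sum>e\<in>?E. \<Sum>f\<in>?E. card (e \<inter> f) + of_bool (disjnt e f))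
      = (\<Sum>e\<in>?E. \<Sum>f\<in>?E. 1 + of_bool (e = f))"
    by (intro sum.cong refl)
  also have "\<dots> = (card ?E)\<^sup>2 + card ?E"
    by (simp only: sum.distrib) (use fin in \<open>simp add: power2_eq_square of_bool_def\<close>)
  finally show ?thesis
    by (simp only: squares pairs sum.distrib)
qed

lemma sum_vdegree_deviation:
  assumes "simple_graph G"
  shows "(\<Sum>v\<in>verts G. (int (vdegree G v) - c)\<^sup>2)
    = (int (num_matchings G 1))\<^sup>2 + int (num_matchings G 1) - 2 * int (num_matchings G 2)
      - 4 * c * int (num_matchings G 1) + c\<^sup>2 * int (graph_order G)"
proof -
  have "(\<Sum>v\<in>verts G. (int (vdegree G v) - c)\<^sup>2)
      = int (\<Sum>v\<in>verts G. (vdegree G v)\<^sup>2) - 2 * c * int (\<Sum>v\<in>verts G. vdegree G v)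
        + c\<^sup>2 * int (graph_order G)"
    by (simp add: power2_diff sum.distrib sum_subtractf sum_distrib_left graph_order_def
        algebra_simps)
  moreover have "int (\<Sum>v\<in>verts G. (vdegree G v)\<^sup>2) + 2 * int (num_matchings G 2)
      = (int (num_matchings G 1))\<^sup>2 + int (num_matchings G 1)"
    using arg_cong[OF sum_vdegree_squared[OF assms], of int] by (simp add: num_matchings_1[unfolded One_nat_def])
  ultimately show ?thesis
    using sum_vdegree[OF assms] by (simp add: num_matchings_1[unfolded One_nat_def] algebra_simps)
qed

text \<open>The sum of the \<open>(d(v) - r)\<^sup>2\<close> is a function of the order and of the first two matching numbers, and
  it vanishes exactly for \<open>r\<close>-regular graphs. The bound on the order makes \<open>\<rho>\<^sub>2\<close> one of the
  coefficients of the matching polynomial.\<close>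

lemma regular_graph_if_matching_poly_eq:
  assumes G: "simple_graph G" "regular_graph r G" "graph_order G \<ge> 4"
    and H: "simple_graph H" "matching_poly H = matching_poly G"
  shows "regular_graph r H"
proof -
  have "(\<Sum>v\<in>verts H. (int (vdegree H v) - int r)\<^sup>2) = (\<Sum>v\<in>verts G. (int (vdegree G v) - int r)\<^sup>2)"
    using num_matchings_eq[OF G(1) H, of 1] num_matchings_eq[OF G(1) H, of 2] G(3)
    by (simp only: sum_vdegree_deviation[OF G(1)] sum_vdegree_deviation[OF H(1)]
        graph_order_eq[OF G(1) H])
  also have "\<dots> = 0"
    using G(2) by (simp add: regular_graph_def)
  finally show ?thesis
    using H(1) by (simp add: sum_nonneg_eq_0_iff simple_graph_def regular_graph_def)
qed

section \<open>Patterns in cubic graphs of order 10\<close>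

text \<open>A pattern is a list of edges on the vertices \<open>0, \<dots>, 9\<close>, where an edge may be listed in either
  direction. Patterns and all functions on them are executable.\<close>

type_synonym pattern = "(nat \<times> nat) list"

definition adjacent :: "pattern \<Rightarrow> nat \<Rightarrow> nat \<Rightarrow> bool" where
  "adjacent E a b \<longleftrightarrow> (a, b) \<in> set E \<or> (b, a) \<in> set E"

definition neighbours :: "pattern \<Rightarrow> nat \<Rightarrow> nat list" where
  "neighbours E v = filter (adjacent E v) [0..<10]"

definition cubic10 :: "'a ugraph \<Rightarrow> bool" where
  "cubic10 G \<longleftrightarrow> simple_graph G \<and> regular_graph 3 G \<and> graph_order G = 10"

text \<open>The graph may have further edges between the labelled vertices: a pattern records what is known
  so far about a graph.\<close>

definition labels :: "(nat \<Rightarrow> 'a) \<Rightarrow> pattern \<Rightarrow> 'a ugraph \<Rightarrow> bool" where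
  "labels f E G \<longleftrightarrow> bij_betw f {..<10} (verts G) \<and> (\<forall>(a, b)\<in>set E. {f a, f b} \<in> edges G)"

definition contains_pattern :: "'a ugraph \<Rightarrow> pattern \<Rightarrow> bool" where
  "contains_pattern G E \<longleftrightarrow> (\<exists>f. labels f E G)"

lemma no_loop: "simple_graph G \<Longrightarrow> {v, v} \<notin> edges G"
  using card_edge[of G "{v}"] by auto

lemma labels_adjacent: "labels f E G \<Longrightarrow> adjacent E a b \<Longrightarrow> {f a, f b} \<in> edges G"
  by (auto simp: labels_def adjacent_def insert_commute)

text \<open>The degree counts edges and the patterns count neighbours; the two agree because the edges at
  \<open>f v\<close> correspond to their other endpoints.\<close>

lemma card_labelled_neighbours:
  assumes "cubic10 G" and f: "bij_betw f {..<10} (verts G)" and v: "v < 10"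
  shows "card {w \<in> {..<10}. {f v, f w} \<in> edges G} = 3"
proof -
  have G: "simple_graph G"
    using assms(1) by (simp add: cubic10_def)
  let ?N = "{w \<in> {..<10}. {f v, f w} \<in> edges G}"
  have inj: "inj_on f {..<10}"
    using f by (simp add: bij_betw_def)
  have "bij_betw (\<lambda>w. {f v, f w}) ?N {e \<in> edges G. f v \<in> e}"
  proof (rule bij_betwI')
    fix w w' assume "w \<in> ?N" "w' \<in> ?N"
    then show "({f v, f w} = {f v, f w'}) = (w = w')"
      using inj v by (auto simp: doubleton_eq_iff inj_on_def)
  next
    fix w assume "w \<in> ?N"
    then show "{f v, f w} \<in> {e \<in> edges G. f v \<in> e}"
      by simp
  next
    fix e assume e: "e \<in> {e \<in> edges G. f v \<in> e}"
    then have "card e = 2" "e \<subseteq> verts G"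
      using card_edge[OF G] edge_subset_verts[OF G] by auto
    then obtain u where "e = {f v, u}" "u \<in> verts G"
      using e by (auto simp: card_2_iff)
    moreover from this obtain w where "w < 10" "u = f w"
      using f by (auto simp: bij_betw_def)
    ultimately show "\<exists>w\<in>?N. e = {f v, f w}"
      using e by auto
  qed
  then have "card ?N = vdegree G (f v)"
    by (simp add: vdegree_def bij_betw_same_card)
  also have "\<dots> = 3"
    using assms(1) f v by (auto simp: cubic10_def regular_graph_def bij_betw_def)
  finally show ?thesis .
qed

lemma length_neighbours: "length (neighbours E v) = card {w \<in> {..<10}. adjacent E v w}"
  using distinct_card[of "neighbours E v"] by (simp add: neighbours_def atLeast0LessThan)

text \<open>In a cubic graph that contains \<open>E\<close>, a vertex with three neighbours in \<open>E\<close> has no others. So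
  the vertices below are the only ones to which \<open>v\<close> can still be joined, and \<open>completions E v\<close>
  lists all ways to give \<open>v\<close> its missing neighbours.\<close>

definition candidates :: "pattern \<Rightarrow> nat \<Rightarrow> nat list" where
  "candidates E v =
     filter (\<lambda>w. w \<noteq> v \<and> \<not> adjacent E v w \<and> length (neighbours E w) < 3) [0..<10]"

fun sublists_of_length :: "nat \<Rightarrow> 'a list \<Rightarrow> 'a list list" where
  "sublists_of_length 0 xs = [[]]"
| "sublists_of_length (Suc k) [] = []"
| "sublists_of_length (Suc k) (x # xs) =
     map ((#) x) (sublists_of_length k xs) @ sublists_of_length (Suc k) xs"

definition completions :: "pattern \<Rightarrow> nat \<Rightarrow> pattern list" where
  "completions E v =
     map (\<lambda>S. map (Pair v) S @ E)
       (sublists_of_length (3 - length (neighbours E v)) (candidates E v))"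

lemma sublists_of_length_complete:
  assumes "A \<subseteq> set xs" "card A = k"
  shows "\<exists>S\<in>set (sublists_of_length k xs). set S = A"
  using assms
proof (induction k xs arbitrary: A rule: sublists_of_length.induct)
  case (1 xs)
  then have "A = {}"
    using finite_subset by fastforce
  then show ?case
    by simp
next
  case (2 k)
  then show ?case
    by simp
next
  case (3 k x xs)
  show ?case
  proof (cases "x \<in> A")
    case True
    then have "A - {x} \<subseteq> set xs" "card (A - {x}) = k"
      using "3.prems" by auto
    with "3.IH"(1) obtain S where "S \<in> set (sublists_of_length k xs)" "set S = A - {x}"
      by blast
    with True show ?thesis
      by (intro bexI[of _ "x # S"]) auto
  next
    case False
    then show ?thesis
      using "3.IH"(2)[of A] "3.prems" by auto
  qed
qed

text \<open>The case distinction on the neighbourhood of a vertex. If \<open>w\<close> is a neighbour of \<open>v\<close> in the graph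
  but not in \<open>E\<close>, then the neighbours of \<open>w\<close> in \<open>E\<close> are a proper subset of its three neighbours
  in the graph, because \<open>v\<close> is missing; hence \<open>w\<close> is a candidate.\<close>

lemma labels_completion:
  assumes G: "cubic10 G" and f: "labels f E G" and v: "v < 10"
  shows "\<exists>F\<in>set (completions E v). labels f F G"
proof -
  have simple: "simple_graph G" and bij: "bij_betw f {..<10} (verts G)"
    using G f by (auto simp: cubic10_def labels_def)
  let ?N = "\<lambda>u. {w \<in> {..<10}. {f u, f w} \<in> edges G}"
  let ?M = "\<lambda>u. {w \<in> {..<10}. adjacent E u w}"
  have sub: "?M u \<subseteq> ?N u" for u
    using labels_adjacent[OF f] by auto
  have card_N: "card (?N u) = 3" if "u < 10" for u
    using card_labelled_neighbours[OF G bij that] .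
  have "?N v - ?M v \<subseteq> set (candidates E v)"
  proof
    fix w assume w: "w \<in> ?N v - ?M v"
    then have "w \<noteq> v"
      using no_loop[OF simple, of "f v"] by auto
    moreover have "?M w \<subset> ?N w"
    proof -
      have "v \<in> ?N w" "v \<notin> ?M w"
        using w v by (auto simp: insert_commute adjacent_def)
      then show ?thesis
        using sub[of w] by blast
    qed
    then have "card (?M w) < 3"
      using card_N[of w] w psubset_card_mono[of "?N w" "?M w"] by simp
    ultimately show "w \<in> set (candidates E v)"
      using w by (auto simp: candidates_def length_neighbours)
  qed
  moreover have "card (?N v - ?M v) = 3 - length (neighbours E v)"
    using sub[of v] card_N[OF v] by (simp add: card_Diff_subset length_neighbours)
  ultimately obtain S where S: "set S = ?N v - ?M v"
    "S \<in> set (sublists_of_length (3 - length (neighbours E v)) (candidates E v))"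
    using sublists_of_length_complete by blast
  from S(1) f have "labels f (map (Pair v) S @ E) G"
    by (auto simp: labels_def)
  with S(2) show ?thesis
    by (auto simp: completions_def)
qed

section \<open>Case distinctions as data\<close>

text \<open>A plan is a proof tree for the claim that every cubic graph of order 10 that contains a given
  pattern contains one of finitely many patterns \<open>Rs\<close>. An inner node distinguishes the
  neighbourhoods of one vertex, with one subtree for each completion. A leaf names a pattern in
  \<open>Rs\<close> and the list \<open>p\<close> of the labels that its vertices \<open>0, \<dots>, 9\<close> have in the present pattern.\<close>

datatype plan = Follow nat "nat list" | Saturate nat "plan list"

fun covers :: "pattern list \<Rightarrow> pattern \<Rightarrow> plan \<Rightarrow> bool" where
  "covers Rs E (Follow j p) \<longleftrightarrow>
     j < length Rs \<and> length p = 10 \<and> distinct p \<and> (\<forall>i\<in>set p. i < 10) \<and>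
     (\<forall>(a, b)\<in>set (Rs ! j). adjacent E (p ! a) (p ! b))"
| "covers Rs E (Saturate v ps) \<longleftrightarrow> v < 10 \<and> list_all2 (covers Rs) (completions E v) ps"

text \<open>Each row of a table is a pattern with its plan, and a plan may refer to the patterns of later
  rows and to the base. Because references only go forward, following them ends in the base.
  Sharing rows keeps the case distinction small: the same partial graph is reached in many ways.\<close>

fun table_ok :: "pattern list \<Rightarrow> (pattern \<times> plan) list \<Rightarrow> bool" where
  "table_ok base [] \<longleftrightarrow> True"
| "table_ok base ((E, P) # T) \<longleftrightarrow> covers (map fst T @ base) E P \<and> table_ok base T"

lemma labels_relabel:
  fixes f :: "nat \<Rightarrow> 'a"
  assumes "bij_betw f {..<10} V" "length p = 10" "distinct p" "\<forall>i\<in>set p. i < 10"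
  shows "bij_betw (f \<circ> (!) p) {..<10} V"
proof -
  have "set p = {..<10}"
    using assms by (intro card_subset_eq) (auto simp: distinct_card)
  then have "bij_betw ((!) p) {..<10} {..<10}"
    using assms by (intro bij_betw_nth) auto
  then show ?thesis
    using assms(1) bij_betw_trans by blast
qed

lemma covers_sound:
  assumes "covers Rs E P" "labels f E G" "cubic10 G"
  shows "\<exists>R\<in>set Rs. contains_pattern G R"
  using assms(1,2)
proof (induction P arbitrary: E)
  case (Follow j p)
  have "labels (f \<circ> (!) p) (Rs ! j) G"
    unfolding labels_def
  proof
    show "bij_betw (f \<circ> (!) p) {..<10} (verts G)"
      using Follow by (intro labels_relabel) (auto simp: labels_def)
    show "\<forall>(a, b)\<in>set (Rs ! j). {(f \<circ> (!) p) a, (f \<circ> (!) p) b} \<in> edges G"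
      using Follow labels_adjacent by fastforce
  qed
  with Follow show ?case
    by (auto simp: contains_pattern_def)
next
  case (Saturate v ps)
  then have *: "list_all2 (covers Rs) (completions E v) ps" "v < 10"
    by simp_all
  obtain F where F: "F \<in> set (completions E v)" "labels f F G"
    using labels_completion[OF assms(3) Saturate.prems(2) *(2)] by blast
  then obtain i where "i < length (completions E v)" "F = completions E v ! i"
    by (auto simp: in_set_conv_nth)
  then have "ps ! i \<in> set ps" "covers Rs F (ps ! i)"
    using *(1) by (auto simp: list_all2_conv_all_nth)
  with Saturate.IH F(2) show ?case
    by blast
qed

lemma table_ok_sound:
  assumes "table_ok base T" "R \<in> set (map fst T @ base)" "contains_pattern G R" "cubic10 G"
  shows "\<exists>R\<in>set base. contains_pattern G R"
  using assms(1-3)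
proof (induction T arbitrary: R)
  case Nil
  then show ?case
    by auto
next
  case (Cons row T)
  obtain E P where row: "row = (E, P)"
    by (cases row)
  show ?case
  proof (cases "R = E")
    case True
    then obtain f where "labels f E G"
      using Cons.prems(3) by (auto simp: contains_pattern_def)
    then have "\<exists>R'\<in>set (map fst T @ base). contains_pattern G R'"
      using covers_sound[of "map fst T @ base" E P f G] Cons.prems(1) assms(4) by (simp add: row)
    with Cons.IH Cons.prems(1) show ?thesis
      by (auto simp: row)
  next
    case False
    with Cons show ?thesis
      by (auto simp: row)
  qed
qed

definition claw :: pattern where
  "claw = [(0, 1), (0, 2), (0, 3)]"

text \<open>The case distinction starts from a claw instead of the empty pattern, since the first step would
  only list the 84 possible neighbourhoods of a vertex, which are all alike up to relabelling. Here
  the relabelling moves the three neighbours of the vertex 0 to the labels 1, 2 and 3.\<close>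

lemma contains_claw:
  assumes "cubic10 G"
  shows "contains_pattern G claw"
proof -
  have "finite (verts G)" "card (verts G) = 10"
    using assms by (auto simp: cubic10_def simple_graph_def graph_order_def)
  then obtain f where f: "bij_betw f {..<10::nat} (verts G)"
    using ex_bij_betw_nat_finite[of "verts G"] by (auto simp: atLeast0LessThan)
  let ?N = "{w \<in> {..<10}. {f 0, f w} \<in> edges G}"
  obtain a b c where abc: "?N = {a, b, c}" "a \<noteq> b" "b \<noteq> c" "a \<noteq> c"
    using card_labelled_neighbours[OF assms f, of 0] by (auto simp: card_3_iff)
  have "0 \<notin> ?N"
    using assms no_loop[of G "f 0"] by (auto simp: cubic10_def)
  then have ne: "0 \<notin> {a, b, c}"
    by (simp only: abc(1) not_False_eq_True)
  have lt: "{a, b, c} \<subseteq> {..<10}"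
    unfolding abc(1)[symmetric] by blast
  define p where "p = [0, a, b, c] @ filter (\<lambda>i. i \<notin> {0, a, b, c}) [0..<10]"
  have "distinct p"
    using abc ne by (auto simp: p_def)
  moreover have set_p: "set p = {..<10}"
    using lt by (auto simp: p_def)
  ultimately have "length p = 10"
    using distinct_card[of p] by simp
  then have "bij_betw (f \<circ> (!) p) {..<10} (verts G)"
    using f \<open>distinct p\<close> set_p by (intro labels_relabel) auto
  moreover have "{f 0, f w} \<in> edges G" if "w \<in> {a, b, c}" for w
    using that abc(1) by blast
  then have "\<forall>(i, j)\<in>set claw. {(f \<circ> (!) p) i, (f \<circ> (!) p) j} \<in> edges G"
    by (simp add: claw_def p_def numeral_2_eq_2 numeral_3_eq_3)
  ultimately show ?thesis
    unfolding contains_pattern_def labels_def by blast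
qed

section \<open>Matching numbers of cubic patterns\<close>

fun pattern_matchings :: "nat \<Rightarrow> pattern \<Rightarrow> nat" where
  "pattern_matchings 0 E = 1"
| "pattern_matchings (Suc k) [] = 0"
| "pattern_matchings (Suc k) ((a, b) # E) =
     pattern_matchings (Suc k) E +
     pattern_matchings k (filter (\<lambda>(c, d). c \<noteq> a \<and> c \<noteq> b \<and> d \<noteq> a \<and> d \<noteq> b) E)"

text \<open>A \<open>(k + 1)\<close>-matching either avoids the first edge, or consists of it and a \<open>k\<close>-matching of the
  edges disjoint from it. The function \<open>pattern_matchings\<close> evaluates this recursion.\<close>

lemma card_pattern_matchings:
  fixes f :: "nat \<Rightarrow> 'a"
  defines "g \<equiv> \<lambda>(a, b). {f a, f b}"
  assumes "inj_on f L" "set E \<subseteq> L \<times> L" "distinct (map g E)"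
  shows "card {M. M \<subseteq> g ` set E \<and> card M = k \<and> pairwise disjnt M} = pattern_matchings k E"
  using assms(3,4)
proof (induction k E rule: pattern_matchings.induct)
  case (1 E)
  have "{M. M \<subseteq> g ` set E \<and> card M = 0 \<and> pairwise disjnt M} = {{}}"
    by (auto dest: finite_subset)
  then show ?case
    by simp
next
  case (2 k)
  have "{M. M \<subseteq> g ` set [] \<and> card M = Suc k \<and> pairwise disjnt M} = {}"
    by auto
  then show ?case
    by (metis card.empty pattern_matchings.simps(2))
next
  case (3 k a b E)
  let ?e = "{f a, f b}"
  let ?E' = "filter (\<lambda>(c, d). c \<noteq> a \<and> c \<noteq> b \<and> d \<noteq> a \<and> d \<noteq> b) E"
  let ?\<M> = "\<lambda>k A. {M. M \<subseteq> A \<and> card M = k \<and> pairwise disjnt M}"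
  have L: "a \<in> L" "b \<in> L" "set E \<subseteq> L \<times> L"
    using "3.prems" by auto
  have e: "?e \<notin> g ` set E"
    using "3.prems" by (simp add: g_def)
  have E': "g ` set ?E' = {x \<in> g ` set E. disjnt ?e x}"
  proof -
    have "disjnt ?e (g q) \<longleftrightarrow> (case q of (c, d) \<Rightarrow> c \<noteq> a \<and> c \<noteq> b \<and> d \<noteq> a \<and> d \<noteq> b)"
      if "q \<in> set E" for q
      using that L assms(2) by (cases q) (auto simp: g_def disjnt_def inj_on_def)
    then show ?thesis
      by auto
  qed
  have notin: "?e \<notin> M" if "M \<in> ?\<M> k (g ` set ?E')" for M
    using that e unfolding E' by blast
  have fin: "finite A \<Longrightarrow> finite (?\<M> k A)" for k and A :: "'a set set"
    by (rule finite_subset[of _ "Pow A"]) auto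
  have "?\<M> (Suc k) (g ` set ((a, b) # E)) = ?\<M> (Suc k) (g ` set E) \<union> insert ?e ` ?\<M> k (g ` set ?E')"
    (is "?L = ?A \<union> ?B")
  proof (intro equalityI subsetI)
    fix M assume M: "M \<in> ?L"
    show "M \<in> ?A \<union> ?B"
    proof (cases "?e \<in> M")
      case False
      with M show ?thesis
        by (auto simp: g_def)
    next
      case True
      have "finite M"
        using M card.infinite by fastforce
      have "M \<subseteq> insert ?e (g ` set E)" "pairwise disjnt M" "card M = Suc k"
        using M by (auto simp: g_def)
      note M = this
      have "M - {?e} \<subseteq> g ` set ?E'"
        unfolding E' using M(1) pairwiseD[OF M(2) True] by blast
      moreover have "pairwise disjnt (M - {?e})" "card (M - {?e}) = k"
        using M True \<open>finite M\<close> by (auto intro: pairwise_subset)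
      ultimately have "M - {?e} \<in> ?\<M> k (g ` set ?E')"
        by blast
      with True show ?thesis
        by (intro UnI2 image_eqI[of _ _ "M - {?e}"]) auto
    qed
  next
    fix M assume "M \<in> ?A \<union> ?B"
    then show "M \<in> ?L"
    proof
      assume "M \<in> ?A"
      then show ?thesis
        by auto
    next
      assume "M \<in> ?B"
      then obtain M' where M': "M' \<in> ?\<M> k (g ` set ?E')" "M = insert ?e M'"
        by blast
      have "finite M'"
        using M'(1) by (intro finite_subset[of M' "g ` set ?E'"]) (blast, simp)
      then have "card M = Suc k"
        using M' notin[OF M'(1)] by simp
      moreover have "M' \<subseteq> g ` set E" "pairwise disjnt M" and "g (a, b) = ?e"
        using M' unfolding E' by (auto simp: pairwise_insert disjnt_sym g_def)
      ultimately show ?thesis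
        using M'(2) by auto
    qed
  qed
  note split = this
  have "inj_on (insert ?e) (?\<M> k (g ` set ?E'))"
    by (rule inj_onI, rule insert_ident[THEN iffD1, OF notin notin])
  then have "card ?B = card (?\<M> k (g ` set ?E'))"
    by (rule card_image)
  moreover have "card (?A \<union> ?B) = card ?A + card ?B"
  proof (rule card_Un_disjoint)
    show "?A \<inter> ?B = {}"
      using e by blast
  qed (intro fin finite_imageI finite_set)+
  moreover have "distinct (map g ?E')"
    using "3.prems" by (simp add: distinct_map_filter)
  then have "card (?\<M> k (g ` set ?E')) = pattern_matchings k ?E'"
    using L(3) by (intro "3.IH"(2)) auto
  moreover have "card ?A = pattern_matchings (Suc k) E"
    using L(3) "3.prems" by (intro "3.IH"(1)) auto
  ultimately show ?case
    by (simp only: split pattern_matchings.simps)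
qed

text \<open>
  Each edge is listed once, with the smaller vertex first; so different entries are different edges,
  which counting matchings on the list relies on.
\<close>

definition cubic_pattern :: "pattern \<Rightarrow> bool" where
  "cubic_pattern E \<longleftrightarrow> distinct E \<and> (\<forall>(a, b)\<in>set E. a < b \<and> b < 10) \<and>
     (\<forall>v\<in>set [0..<10]. length (neighbours E v) = 3)"

text \<open>A pattern in which every vertex already has three neighbours leaves no room for further edges in
  a cubic graph, so containing the pattern means being isomorphic to it.\<close>

lemma edge_iff_adjacent:
  assumes "cubic_pattern E" "labels f E G" "cubic10 G" "a < 10" "b < 10"
  shows "{f a, f b} \<in> edges G \<longleftrightarrow> adjacent E a b"
proof -
  have "{w \<in> {..<10}. adjacent E a w} = {w \<in> {..<10}. {f a, f w} \<in> edges G}"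
  proof (rule card_subset_eq)
    show "card {w \<in> {..<10}. adjacent E a w} = card {w \<in> {..<10}. {f a, f w} \<in> edges G}"
      using assms card_labelled_neighbours[of G f a]
      by (auto simp: cubic_pattern_def labels_def length_neighbours)
  qed (use labels_adjacent[OF assms(2)] in auto)
  with assms(5) show ?thesis
    by auto
qed

lemma num_matchings_cubic_pattern:
  assumes E: "cubic_pattern E" and f: "labels f E G" and G: "cubic10 G"
  shows "num_matchings G k = pattern_matchings k E"
proof -
  let ?g = "\<lambda>(a, b). {f a, f b}"
  have bij: "bij_betw f {..<10} (verts G)"
    using f by (simp add: labels_def)
  have inj: "inj_on f {..<10}"
    using bij by (simp add: bij_betw_def)
  have bounds: "set E \<subseteq> {..<10} \<times> {..<10}"
    using E by (fastforce simp: cubic_pattern_def)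
  have "edges G = ?g ` set E"
  proof (intro equalityI subsetI)
    fix e assume e: "e \<in> edges G"
    then have "card e = 2" "e \<subseteq> f ` {..<10}"
      using card_edge[of G e] edge_subset_verts[of G e] G bij by (auto simp: cubic10_def bij_betw_def)
    then obtain a b where ab: "e = {f a, f b}" "a < 10" "b < 10"
      by (auto simp: card_2_iff)
    then have "adjacent E a b"
      using edge_iff_adjacent[OF E f G] e by blast
    then show "e \<in> ?g ` set E"
      using ab(1) by (force simp: adjacent_def insert_commute)
  next
    fix e assume "e \<in> ?g ` set E"
    then show "e \<in> edges G"
      using f by (auto simp: labels_def)
  qed
  moreover have "distinct (map ?g E)"
  proof -
    have "inj_on ?g (set E)"
    proof (rule inj_onI)
      fix p q assume pq: "p \<in> set E" "q \<in> set E" "?g p = ?g q"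
      obtain a b c d where p: "p = (a, b)" and q: "q = (c, d)"
        by (cases p, cases q)
      have ord: "a < b" "c < d" "b < 10" "d < 10"
        using E pq by (auto simp: cubic_pattern_def p q)
      then have "(a = c \<and> b = d) \<or> (a = d \<and> b = c)"
        using pq(3) inj by (auto simp: p q doubleton_eq_iff inj_on_def)
      with ord show "p = q"
        by (auto simp: p q)
    qed
    then show ?thesis
      using E by (simp add: distinct_map cubic_pattern_def)
  qed
  ultimately show ?thesis
    using card_pattern_matchings[OF inj bounds, of k]
    by (simp add: num_matchings_def k_matchings_def)
qed

lemma isomorphic_if_same_cubic_pattern:
  assumes E: "cubic_pattern E" and G: "contains_pattern G E" "cubic10 G"
    and H: "contains_pattern H E" "cubic10 H"
  shows "graph_isomorphic H G"
proof -
  obtain f h where f: "labels f E G" and h: "labels h E H"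
    using G H by (auto simp: contains_pattern_def)
  define i where "i = the_inv_into {..<10} h"
  have bij_h: "bij_betw h {..<10} (verts H)"
    using h by (simp add: labels_def)
  then have bij_i: "bij_betw i (verts H) {..<10}"
    by (simp add: i_def bij_betw_the_inv_into)
  have hi: "h (i u) = u" "i u < 10" if "u \<in> verts H" for u
    using that bij_h bij_i by (auto simp: i_def f_the_inv_into_f_bij_betw bij_betw_def)
  have "{u, v} \<in> edges H \<longleftrightarrow> {(f \<circ> i) u, (f \<circ> i) v} \<in> edges G"
    if "u \<in> verts H" "v \<in> verts H" for u v
    using edge_iff_adjacent[OF E h H(2), of "i u" "i v"] edge_iff_adjacent[OF E f G(2), of "i u" "i v"]
      that hi by simp
  moreover have "bij_betw (f \<circ> i) (verts H) (verts G)"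
    using bij_betw_trans[OF bij_i, of f] f by (auto simp: labels_def)
  ultimately show ?thesis
    unfolding graph_isomorphic_def by blast
qed

section \<open>The 21 cubic graphs of order 10\<close>

text \<open>The cubic graphs of order 10, in lexicographic order of their matching numbers. The first and the
  fifth are the disjoint unions of \<open>K\<^sub>4\<close> with the triangular prism and with \<open>K\<^sub>3\<^sub>,\<^sub>3\<close>; the
  sixteenth is the Petersen graph.\<close>

definition cubic_patterns :: "pattern list" where
  "cubic_patterns = [
   [(0,1), (0,2), (0,3), (1,2), (1,3), (2,3), (4,5), (4,6), (4,7), (5,8), (5,9), (6,7), (6,9),
    (7,8), (8,9)],
   [(0,1), (0,2), (0,3), (1,2), (1,3), (2,4), (3,5), (4,6), (4,7), (5,8), (5,9), (6,7), (6,8),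
    (7,9), (8,9)],
   [(0,1), (0,2), (0,3), (1,2), (1,3), (2,4), (3,5), (4,5), (4,6), (5,7), (6,8), (6,9), (7,8),
    (7,9), (8,9)],
   [(0,1), (0,2), (0,3), (1,2), (1,3), (2,4), (3,4), (4,5), (5,6), (5,7), (6,8), (6,9), (7,8),
    (7,9), (8,9)],
   [(0,1), (0,2), (0,3), (1,2), (1,3), (2,3), (4,5), (4,6), (4,7), (5,8), (5,9), (6,8), (6,9),
    (7,8), (7,9)],
   [(0,1), (0,2), (0,3), (1,2), (1,4), (2,5), (3,6), (3,7), (4,7), (4,8), (5,6), (5,9), (6,9),
    (7,8), (8,9)],
   [(0,1), (0,2), (0,3), (1,2), (1,3), (2,4), (3,5), (4,6), (4,7), (5,6), (5,8), (6,9), (7,8),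
    (7,9), (8,9)],
   [(0,1), (0,2), (0,3), (1,2), (1,4), (2,5), (3,6), (3,7), (4,6), (4,8), (5,6), (5,9), (7,8),
    (7,9), (8,9)],
   [(0,1), (0,2), (0,3), (1,2), (1,4), (2,5), (3,6), (3,7), (4,6), (4,7), (5,8), (5,9), (6,9),
    (7,8), (8,9)],
   [(0,1), (0,2), (0,3), (1,2), (1,4), (2,5), (3,4), (3,6), (4,7), (5,6), (5,8), (6,9), (7,8),
    (7,9), (8,9)],
   [(0,1), (0,2), (0,3), (1,2), (1,4), (2,5), (3,4), (3,6), (4,7), (5,8), (5,9), (6,7), (6,8),
    (7,9), (8,9)],
   [(0,1), (0,2), (0,3), (1,2), (1,3), (2,4), (3,5), (4,6), (4,7), (5,8), (5,9), (6,8), (6,9),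
    (7,8), (7,9)],
   [(0,1), (0,2), (0,3), (1,2), (1,4), (2,5), (3,6), (3,7), (4,6), (4,8), (5,7), (5,9), (6,9),
    (7,8), (8,9)],
   [(0,1), (0,2), (0,3), (1,2), (1,4), (2,5), (3,6), (3,7), (4,6), (4,8), (5,7), (5,8), (6,9),
    (7,9), (8,9)],
   [(0,1), (0,2), (0,3), (1,2), (1,4), (2,5), (3,4), (3,6), (4,7), (5,8), (5,9), (6,8), (6,9),
    (7,8), (7,9)],
   [(0,1), (0,2), (0,3), (1,4), (1,5), (2,6), (2,7), (3,8), (3,9), (4,6), (4,9), (5,7), (5,8),
    (6,8), (7,9)],
   [(0,1), (0,2), (0,3), (1,4), (1,5), (2,4), (2,6), (3,7), (3,8), (4,8), (5,7), (5,9), (6,7),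
    (6,9), (8,9)],
   [(0,1), (0,2), (0,3), (1,4), (1,5), (2,4), (2,6), (3,5), (3,7), (4,8), (5,9), (6,7), (6,9),
    (7,8), (8,9)],
   [(0,1), (0,2), (0,3), (1,4), (1,5), (2,4), (2,6), (3,6), (3,7), (4,8), (5,7), (5,8), (6,9),
    (7,9), (8,9)],
   [(0,1), (0,2), (0,3), (1,4), (1,5), (2,4), (2,6), (3,5), (3,7), (4,8), (5,9), (6,8), (6,9),
    (7,8), (7,9)],
   [(0,1), (0,2), (0,3), (1,4), (1,5), (2,4), (2,5), (3,6), (3,7), (4,8), (5,9), (6,8), (6,9),
    (7,8), (7,9)]]"

text \<open>A reference \<open>Follow j p\<close> means the \<open>j\<close>-th row after its own, counting from 0, and running on into
  \<open>cubic_patterns\<close> after the last row. The table is the record of a depth-first search that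
  in each pattern completes a vertex with few cases. A pattern that is reached only once needs no
  row of its own and appears as a nested \<open>Saturate\<close>. A \<open>Saturate\<close> with an empty list closes a dead
  end, where a vertex has too few candidates left.\<close>

definition case_table :: "(pattern \<times> plan) list" where
  "case_table = [
   ([(0,1), (0,2), (0,3)],
    Saturate 3 [
     Follow 33 [0,3,1,2,4,5,6,7,8,9], Follow 17 [0,3,1,2,4,5,6,7,8,9],
     Follow 17 [0,3,1,2,5,4,6,7,8,9], Follow 17 [0,3,1,2,6,4,5,7,8,9],
     Follow 17 [0,3,1,2,7,4,5,6,8,9], Follow 17 [0,3,1,2,8,4,5,6,7,9],
     Follow 17 [0,3,1,2,9,4,5,6,7,8], Follow 17 [0,3,2,1,4,5,6,7,8,9],
     Follow 17 [0,3,2,1,5,4,6,7,8,9], Follow 17 [0,3,2,1,6,4,5,7,8,9],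
     Follow 17 [0,3,2,1,7,4,5,6,8,9], Follow 17 [0,3,2,1,8,4,5,6,7,9],
     Follow 17 [0,3,2,1,9,4,5,6,7,8], Follow 0 [0,3,1,2,4,5,6,7,8,9],
     Follow 0 [0,3,1,2,4,6,5,7,8,9], Follow 0 [0,3,1,2,4,7,5,6,8,9],
     Follow 0 [0,3,1,2,8,4,5,6,7,9], Follow 0 [0,3,1,2,9,4,5,6,7,8],
     Follow 0 [0,3,1,2,5,6,4,7,8,9], Follow 0 [0,3,1,2,5,7,4,6,8,9],
     Follow 0 [0,3,1,2,8,5,4,6,7,9], Follow 0 [0,3,1,2,9,5,4,6,7,8],
     Follow 0 [0,3,1,2,6,7,4,5,8,9], Follow 0 [0,3,1,2,8,6,4,5,7,9],
     Follow 0 [0,3,1,2,9,6,4,5,7,8], Follow 0 [0,3,1,2,8,7,4,5,6,9],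
     Follow 0 [0,3,1,2,9,7,4,5,6,8], Follow 0 [0,3,1,2,8,9,4,5,6,7]]),
   ([(0,1), (0,2), (0,3), (1,4), (1,5)],
    Saturate 4 [
     Follow 10 [1,0,4,5,2,3,6,7,8,9], Follow 16 [1,4,5,0,2,3,6,7,8,9],
     Follow 3 [1,0,4,5,2,3,6,7,8,9], Follow 3 [1,0,4,5,2,3,7,6,8,9],
     Follow 3 [1,0,4,5,2,3,8,6,7,9], Follow 3 [1,0,4,5,2,3,9,6,7,8],
     Follow 16 [1,4,5,0,3,2,6,7,8,9], Follow 3 [1,0,4,5,3,2,6,7,8,9],
     Follow 3 [1,0,4,5,3,2,7,6,8,9], Follow 3 [1,0,4,5,3,2,8,6,7,9],
     Follow 3 [1,0,4,5,3,2,9,6,7,8], Follow 16 [1,4,5,0,6,2,3,7,8,9],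
     Follow 16 [1,4,5,0,7,2,3,6,8,9], Follow 16 [1,4,5,0,8,2,3,6,7,9],
     Follow 16 [1,4,5,0,9,2,3,6,7,8], Follow 0 [1,0,4,5,2,3,6,7,8,9],
     Follow 0 [1,0,4,5,2,3,8,6,7,9], Follow 0 [1,0,4,5,2,3,9,6,7,8],
     Follow 0 [1,0,4,5,2,3,8,7,6,9], Follow 0 [1,0,4,5,2,3,9,7,6,8],
     Follow 0 [1,0,4,5,2,3,8,9,6,7]]),
   ([(0,1), (0,2), (0,3), (1,4), (1,5), (2,6), (2,7)],
    Saturate 3 [
     Follow 9 [0,1,3,2,4,5,6,7,8,9], Follow 2 [0,1,3,2,4,5,6,7,8,9],
     Follow 2 [0,1,3,2,4,5,7,6,8,9], Follow 2 [0,1,3,2,4,5,8,6,7,9],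
     Follow 2 [0,1,3,2,4,5,9,6,7,8], Follow 2 [0,1,3,2,5,4,6,7,8,9],
     Follow 2 [0,1,3,2,5,4,7,6,8,9], Follow 2 [0,1,3,2,5,4,8,6,7,9],
     Follow 2 [0,1,3,2,5,4,9,6,7,8], Follow 9 [0,2,3,1,6,7,4,5,8,9],
     Follow 2 [0,2,3,1,6,7,8,4,5,9], Follow 2 [0,2,3,1,6,7,9,4,5,8],
     Follow 2 [0,2,3,1,7,6,8,4,5,9], Follow 2 [0,2,3,1,7,6,9,4,5,8],
     Saturate 7 [
      Follow 1 [0,1,2,3,4,5,7,6,8,9], Follow 15 [2,7,6,0,4,1,5,3,8,9],
      Follow 0 [0,1,2,3,4,5,7,6,8,9], Follow 0 [0,1,2,3,4,5,7,6,9,8],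
      Follow 15 [2,7,6,0,5,1,4,3,8,9], Follow 0 [0,1,2,3,5,4,7,6,8,9],
      Follow 0 [0,1,2,3,5,4,7,6,9,8], Follow 15 [2,7,6,0,8,1,4,5,3,9],
      Follow 15 [2,7,6,0,9,1,4,5,3,8], Follow 1 [0,3,2,1,8,9,7,6,4,5]]]),
   ([(0,1), (0,2), (0,3), (1,4), (1,5), (2,6), (2,7), (3,8), (3,9), (4,6), (6,8)],
    Saturate 8 [
     Follow 18 [8,4,6,3,1,2,0,9,7,5],
     Saturate 7 [
      Follow 5 [5,1,7,8,4,0,2,3,6,9], Follow 6 [2,7,6,0,4,9,8,3,1,5],
      Saturate 4 [
       Follow 63 [8,6,5,3,4,2,1,7,0,9]]],
     Follow 1 [6,2,8,4,7,0,3,1,5,9], Follow 14 [3,8,9,0,6,1,4,5,2,7]]),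
   ([(0,1), (0,2), (0,3), (1,4), (1,5), (2,6), (2,7), (3,8), (3,9), (4,6), (5,6)],
    Saturate 5 [
     Follow 38 [5,4,1,6,0,2,3,7,8,9], Follow 0 [5,1,6,7,4,0,2,3,8,9],
     Follow 0 [5,1,6,8,4,0,2,3,7,9], Follow 0 [5,1,6,9,4,0,2,3,7,8]]),
   ([(0,1), (0,2), (0,3), (1,4), (1,5), (2,4), (2,6)],
    Saturate 4 [
     Follow 7 [1,4,0,5,2,3,6,7,8,9], Follow 12 [1,4,5,0,2,3,6,7,8,9],
     Follow 12 [4,2,6,1,0,5,3,7,8,9], Follow 0 [1,4,0,5,2,7,3,6,8,9],
     Follow 0 [1,4,0,5,2,8,3,6,7,9], Follow 0 [1,4,0,5,2,9,3,6,7,8]]),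
   ([(0,1), (0,2), (0,3), (1,4), (1,5), (2,4), (2,6), (4,7)],
    Saturate 8 [
     Follow 3 [0,1,2,3,4,5,6,8,7,9], Follow 3 [1,0,4,5,2,3,7,8,6,9],
     Follow 2 [1,0,4,5,2,3,7,8,6,9], Follow 3 [2,0,4,6,1,3,7,8,5,9],
     Follow 2 [2,0,4,6,1,3,7,8,5,9], Follow 0 [0,1,2,3,4,5,6,8,7,9],
     Follow 3 [4,1,2,7,0,5,6,8,3,9], Follow 0 [1,0,4,5,2,3,7,8,6,9],
     Follow 2 [4,1,2,7,0,5,6,8,3,9], Follow 2 [4,2,1,7,0,6,5,8,3,9]]),
   ([(0,1), (0,2), (0,3), (1,4), (1,5), (2,4), (2,6), (3,7), (4,8), (7,8), (7,9)],
    Saturate 3 [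
     Follow 0 [1,0,4,5,2,3,8,6,7,9], Follow 0 [2,0,4,6,1,3,8,5,7,9],
     Follow 18 [3,7,8,0,9,4,1,2,5,6], Follow 10 [3,7,9,0,8,1,2,4,6,5]]),
   ([(0,1), (0,2), (0,3), (1,4), (1,5), (2,4), (2,6), (3,5), (4,7), (5,8), (6,8), (8,9)],
    Saturate 9 [
     Follow 20 [8,9,6,5,3,2,1,0,4,7],
     Saturate 6 [
      Follow 62 [0,1,2,3,4,5,6,9,7,8]],
     Follow 12 [8,9,6,5,7,2,1,3,4,0]]),
   ([(0,1), (0,2), (0,3), (1,4), (1,5), (2,4), (2,6), (3,7), (4,8), (5,7), (7,9)],
    Saturate 9 [
     Follow 33 [9,7,5,3,1,0,4,2,6,8], Follow 10 [3,7,9,0,5,6,1,2,4,8],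
     Follow 10 [3,7,9,0,5,8,1,2,4,6], Follow 10 [5,7,9,1,3,6,4,0,2,8],
     Follow 10 [5,7,9,1,3,8,4,0,2,6],
     Saturate 6 [
      Saturate 8 [
       Follow 60 [0,1,2,3,4,5,6,7,8,9]],
      Follow 1 [2,4,0,6,1,8,3,5,9,7], Follow 18 [8,6,9,4,2,7,1,0,5,3]]]),
   ([(0,1), (0,2), (0,3), (1,4), (1,5), (2,4), (2,6), (3,7), (4,8), (5,7), (6,7)],
    Saturate 9 [
     Follow 4 [6,7,9,2,5,3,4,1,0,8], Follow 0 [3,7,9,0,5,6,8,1,2,4],
     Follow 0 [6,9,7,2,3,8,5,0,4,1],
     Saturate 8 [
      Follow 57 [4,1,2,8,0,5,6,9,3,7]]]),
   ([(0,1), (0,2), (0,3), (1,4), (1,5), (2,4), (2,6), (3,7), (3,8), (4,7), (5,8), (6,9), (7,9),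
    (8,9)],
    Saturate 6 [
     Follow 57 [8,9,3,5,7,6,0,1,4,2]]),
   ([(0,1), (0,2), (0,3), (1,4), (1,5), (2,4), (2,5)],
    Saturate 4 [
     Saturate 5 [
      Saturate 9 [
       Saturate 7 [
        Follow 21 [7,9,8,6,1,4,5,0,2,3]]],
      Follow 3 [4,1,2,3,0,5,6,7,8,9], Follow 3 [4,1,2,3,0,5,7,6,8,9],
      Follow 3 [4,1,2,3,0,5,8,6,7,9], Follow 3 [4,1,2,3,0,5,9,6,7,8]],
     Follow 33 [5,4,1,2,0,3,6,7,8,9], Follow 0 [4,1,2,6,0,5,3,7,8,9],
     Follow 0 [4,1,2,7,0,5,3,6,8,9], Follow 0 [4,1,2,8,0,5,3,6,7,9],
     Follow 0 [4,1,2,9,0,5,3,6,7,8]]),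
   ([(0,1), (0,2), (0,3), (1,4), (1,5), (2,4), (2,5), (4,6)],
    Saturate 5 [
     Follow 2 [0,1,2,3,5,4,6,7,8,9], Follow 2 [5,1,2,6,4,0,3,7,8,9],
     Follow 0 [0,1,2,3,5,4,7,6,8,9], Follow 0 [0,1,2,3,5,4,8,6,7,9],
     Follow 0 [0,1,2,3,5,4,9,6,7,8]]),
   ([(0,1), (0,2), (0,3), (1,4), (1,5), (2,4), (2,5), (4,6), (5,7)],
    Saturate 9 [
     Saturate 8 [
      Follow 57 [0,1,2,3,4,5,8,9,6,7]],
     Follow 0 [4,1,2,6,0,5,9,3,7,8], Follow 0 [5,1,2,7,0,4,9,3,6,8],
     Follow 0 [5,1,2,7,4,0,9,6,3,8]]),
   ([(0,1), (0,2), (0,3), (1,4), (1,5), (2,4), (2,5), (3,6), (4,7), (5,8), (6,7), (6,9)],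
    Saturate 9 [
     Follow 23 [6,9,3,7,0,4,1,2,5,8], Follow 4 [3,9,6,0,8,7,1,2,4,5],
     Follow 4 [7,9,6,4,8,3,1,2,5,0]]),
   ([(0,1), (0,2), (0,3), (1,4), (1,5), (2,4), (2,5), (3,4), (5,6)],
    Saturate 3 [
     Saturate 9 [
      Saturate 8 []],
     Follow 0 [0,1,2,3,4,5,7,6,8,9], Follow 0 [0,1,2,3,4,5,8,6,7,9],
     Follow 0 [0,1,2,3,4,5,9,6,7,8]]),
   ([(0,1), (0,2), (0,3), (1,4), (1,5), (2,4), (2,5), (3,4), (3,6), (5,7)],
    Saturate 9 [
     Saturate 8 [
      Follow 45 [9,8,7,6,5,3,1,2,0,4]]]),
   ([(0,1), (0,2), (0,3), (1,2), (1,4)],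
    Saturate 2 [
     Follow 16 [2,0,1,3,4,5,6,7,8,9], Follow 16 [1,2,0,4,3,5,6,7,8,9],
     Follow 0 [0,2,1,3,5,4,6,7,8,9], Follow 0 [0,2,1,3,6,4,5,7,8,9],
     Follow 0 [0,2,1,3,7,4,5,6,8,9], Follow 0 [0,2,1,3,8,4,5,6,7,9],
     Follow 0 [0,2,1,3,9,4,5,6,7,8]]),
   ([(0,1), (0,2), (0,3), (1,2), (1,4), (2,5)],
    Saturate 5 [
     Saturate 3 [
      Saturate 8 [
       Saturate 9 [
        Follow 14 [9,8,7,6,0,1,3,2,5,4]]],
      Follow 12 [2,0,1,5,3,4,6,7,8,9], Follow 12 [2,0,1,5,3,4,7,6,8,9],
      Follow 12 [2,0,1,5,3,4,8,6,7,9], Follow 12 [2,0,1,5,3,4,9,6,7,8]],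
     Follow 7 [2,0,1,5,3,4,6,7,8,9], Follow 7 [2,0,1,5,3,4,7,6,8,9],
     Follow 7 [2,0,1,5,3,4,8,6,7,9], Follow 7 [2,0,1,5,3,4,9,6,7,8],
     Follow 7 [2,1,0,5,4,3,6,7,8,9], Follow 7 [2,1,0,5,4,3,7,6,8,9],
     Follow 7 [2,1,0,5,4,3,8,6,7,9], Follow 7 [2,1,0,5,4,3,9,6,7,8],
     Follow 0 [2,0,1,5,3,4,6,7,8,9], Follow 0 [2,0,1,5,3,4,8,6,7,9],
     Follow 0 [2,0,1,5,3,4,9,6,7,8], Follow 0 [2,0,1,5,3,4,8,7,6,9],
     Follow 0 [2,0,1,5,3,4,9,7,6,8], Follow 0 [2,0,1,5,3,4,8,9,6,7]]),
   ([(0,1), (0,2), (0,3), (1,2), (1,4), (2,5), (3,6), (3,7)],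
    Saturate 5 [
     Follow 6 [2,1,0,5,4,3,6,7,8,9], Follow 6 [2,1,0,5,4,3,7,6,8,9],
     Follow 6 [2,1,0,5,4,3,8,6,7,9], Follow 6 [2,1,0,5,4,3,9,6,7,8],
     Follow 4 [2,1,0,5,4,3,6,7,8,9], Follow 1 [2,1,0,5,4,3,6,8,7,9],
     Follow 1 [2,1,0,5,4,3,6,9,7,8], Follow 1 [2,1,0,5,4,3,7,8,6,9],
     Follow 1 [2,1,0,5,4,3,7,9,6,8], Follow 0 [2,1,0,5,4,3,8,9,6,7]]),
   ([(0,1), (0,2), (0,3), (1,2), (1,4), (2,5), (3,6), (3,7), (5,8), (5,9)],
    Saturate 4 [
     Follow 3 [1,2,0,4,5,3,6,7,8,9], Follow 0 [1,0,2,4,3,5,8,6,9,7],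
     Follow 0 [1,0,2,4,3,5,9,6,8,7], Follow 0 [1,0,2,4,3,5,8,7,9,6],
     Follow 0 [1,0,2,4,3,5,9,7,8,6], Follow 3 [1,0,2,4,3,5,8,9,6,7]]),
   ([(0,1), (0,2), (0,3), (1,2), (1,4), (2,5), (3,6), (3,7), (5,6), (5,8)],
    Saturate 9 [
     Follow 1 [0,1,2,3,4,5,6,7,9,8], Follow 1 [2,1,0,5,4,3,6,8,9,7],
     Saturate 4 [
      Saturate 8 [
       Follow 36 [0,1,2,3,4,5,6,7,9,8]],
      Follow 0 [0,1,2,3,4,5,7,6,9,8], Follow 0 [2,1,0,5,4,3,8,6,9,7]],
     Saturate 4 [
      Follow 42 [0,1,2,3,4,5,7,6,8,9]]]),
   ([(0,1), (0,2), (0,3), (1,2), (1,4), (2,5), (3,6), (3,7), (4,6), (4,8), (5,7), (5,9), (6,8),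
    (8,9)],
    Saturate 7 [
     Follow 33 [0,1,2,3,4,5,7,6,8,9]]),
   ([(0,1), (0,2), (0,3), (1,2), (1,4), (2,5), (3,6), (3,7), (4,8), (5,6), (5,9), (6,8), (7,8)],
    Saturate 9 [
     Follow 39 [2,1,0,5,4,3,9,6,8,7]]),
   ([(0,1), (0,2), (0,3), (1,2), (1,4), (2,5), (3,6), (3,7), (5,6), (5,7)],
    Saturate 6 [
     Saturate 9 [
      Saturate 8 []],
     Follow 19 [7,6,5,3,2,0,1,4,8,9], Follow 0 [0,1,2,3,4,5,6,7,8,9],
     Follow 0 [0,1,2,3,4,5,6,7,9,8]]),
   ([(0,1), (0,2), (0,3), (1,2), (1,4), (2,5), (3,6), (3,7), (5,6), (5,7), (6,8)],
    Saturate 9 [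
     Saturate 8 [
      Follow 33 [8,9,4,6,7,1,5,3,0,2]]]),
   ([(0,1), (0,2), (0,3), (1,2), (1,4), (2,5), (3,4), (3,6)],
    Saturate 4 [
     Follow 4 [1,0,2,4,3,5,6,7,8,9],
     Saturate 6 [
      Saturate 9 [
       Saturate 7 []],
      Follow 3 [0,1,2,3,4,5,6,7,8,9], Follow 3 [0,1,2,3,4,5,6,8,7,9],
      Follow 3 [0,1,2,3,4,5,6,9,7,8]],
     Follow 0 [0,1,2,3,4,5,6,7,8,9], Follow 0 [0,1,2,3,4,5,6,8,7,9],
     Follow 0 [0,1,2,3,4,5,6,9,7,8]]),
   ([(0,1), (0,2), (0,3), (1,2), (1,4), (2,5), (3,4), (3,6), (4,7)],
    Saturate 8 [
     Saturate 9 [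
      Follow 37 [0,1,2,3,4,5,6,7,8,9]],
     Follow 0 [0,1,2,3,4,5,6,7,8,9], Follow 0 [1,0,2,4,3,5,7,6,8,9],
     Saturate 9 [
      Follow 1 [0,1,2,3,4,5,6,7,9,8], Follow 1 [1,0,2,4,3,5,7,6,9,8],
      Follow 15 [9,8,6,7,3,4,0,1,2,5]]]),
   ([(0,1), (0,2), (0,3), (1,2), (1,4), (2,5), (3,4), (3,6), (4,7), (5,8), (6,8), (8,9)],
    Saturate 9 [
     Follow 11 [9,8,6,5,3,2,4,0,1,7],
     Saturate 7 [
      Follow 32 [0,1,2,3,4,5,6,7,8,9]],
     Follow 0 [0,1,2,3,4,5,6,7,8,9]]),
   ([(0,1), (0,2), (0,3), (1,2), (1,4), (2,5), (3,4), (3,6), (4,7), (5,8), (6,8), (6,9), (7,9),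
    (8,9)],
    Saturate 7 [
     Follow 30 [9,8,6,7,5,3,4,2,0,1]]),
   ([(0,1), (0,2), (0,3), (1,2), (1,4), (2,5), (3,4), (3,6), (4,6), (6,7)],
    Saturate 9 [
     Saturate 8 [
      Follow 21 [9,8,5,7,2,6,1,0,4,3]]]),
   ([(0,1), (0,2), (0,3), (1,2), (1,4), (2,5), (3,4), (3,5), (4,6)],
    Saturate 5 [
     Saturate 8 [
      Saturate 7 []],
     Follow 0 [0,1,2,3,4,5,6,7,8,9], Follow 0 [0,1,2,3,4,5,6,8,7,9],
     Follow 0 [0,1,2,3,4,5,6,9,7,8]]),
   ([(0,1), (0,2), (0,3), (1,2), (1,4), (2,5), (3,4), (3,5), (4,6), (5,7)],
    Saturate 8 [
     Saturate 9 [
      Follow 24 [9,8,6,7,4,5,3,1,2,0]]]),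
   ([(0,1), (0,2), (0,3), (1,2), (1,3)],
    Saturate 3 [
     Saturate 8 [
      Follow 13 [0,2,3,1,8,4,5,6,7,9], Follow 13 [0,2,3,1,8,4,5,7,6,9],
      Follow 13 [0,2,3,1,8,9,4,5,6,7], Follow 13 [0,2,3,1,8,4,6,7,5,9],
      Follow 13 [0,2,3,1,8,9,4,6,5,7], Follow 13 [0,2,3,1,8,9,4,7,5,6],
      Follow 13 [0,2,3,1,8,5,6,7,4,9], Follow 13 [0,2,3,1,8,9,5,6,4,7],
      Follow 13 [0,2,3,1,8,9,5,7,4,6], Follow 13 [0,2,3,1,8,9,6,7,4,5]],
     Follow 0 [1,0,3,2,4,5,6,7,8,9], Follow 0 [1,0,3,2,5,4,6,7,8,9],
     Follow 0 [1,0,3,2,6,4,5,7,8,9], Follow 0 [1,0,3,2,7,4,5,6,8,9],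
     Follow 0 [1,0,3,2,8,4,5,6,7,9], Follow 0 [1,0,3,2,9,4,5,6,7,8]]),
   ([(0,1), (0,2), (0,3), (1,2), (1,3), (2,4)],
    Saturate 3 [
     Saturate 4 [
      Follow 10 [0,1,3,2,4,5,6,7,8,9], Follow 10 [0,1,3,2,4,6,5,7,8,9],
      Follow 10 [0,1,3,2,4,7,5,6,8,9], Follow 10 [0,1,3,2,4,8,5,6,7,9],
      Follow 10 [0,1,3,2,4,9,5,6,7,8]],
     Follow 0 [0,1,3,2,5,4,6,7,8,9], Follow 0 [0,1,3,2,6,4,5,7,8,9],
     Follow 0 [0,1,3,2,7,4,5,6,8,9], Follow 0 [0,1,3,2,8,4,5,6,7,9],
     Follow 0 [0,1,3,2,9,4,5,6,7,8]]),
   ([(0,1), (0,2), (0,3), (1,2), (1,3), (2,4), (3,5)],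
    Saturate 4 [
     Follow 5 [0,1,2,3,4,5,6,7,8,9], Follow 5 [0,1,2,3,4,5,7,6,8,9],
     Follow 5 [0,1,2,3,4,5,8,6,7,9], Follow 5 [0,1,2,3,4,5,9,6,7,8],
     Follow 0 [0,1,2,3,4,5,6,7,8,9], Follow 0 [0,1,2,3,4,5,8,6,7,9],
     Follow 0 [0,1,2,3,4,5,6,9,7,8], Follow 0 [0,1,2,3,4,5,8,7,6,9],
     Follow 0 [0,1,2,3,4,5,9,7,6,8], Follow 0 [0,1,2,3,4,5,8,9,6,7]]),
   ([(0,1), (0,2), (0,3), (1,2), (1,3), (2,4), (3,5), (4,6), (4,7)],
    Saturate 8 [
     Follow 3 [0,1,2,3,4,5,6,7,8,9], Follow 0 [0,1,2,3,4,5,6,7,8,9],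
     Follow 0 [0,1,2,3,4,5,7,6,8,9], Follow 1 [0,1,2,3,4,5,6,7,8,9]]),
   ([(0,1), (0,2), (0,3), (1,2), (1,3), (2,4), (3,5), (4,6), (4,7), (5,8), (6,8), (8,9)],
    Saturate 9 [
     Follow 2 [0,1,3,2,5,4,8,9,6,7],
     Saturate 6 [
      Follow 14 [0,1,2,3,4,5,6,7,8,9]],
     Follow 1 [0,1,2,3,4,5,6,7,8,9]]),
   ([(0,1), (0,2), (0,3), (1,2), (1,3), (2,4), (3,5), (4,6), (4,7), (6,8), (7,8), (8,9)],
    Saturate 9 [
     Follow 0 [0,1,2,3,4,5,6,7,9,8], Follow 0 [0,1,2,3,4,5,7,6,9,8],
     Follow 7 [9,8,6,7,4,2,1,3,0,5]]),
   ([(0,1), (0,2), (0,3), (1,2), (1,3), (2,4), (3,5), (4,6), (4,7), (5,8), (6,8), (6,9), (7,9),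
    (8,9)],
    Saturate 7 [
     Follow 17 [0,1,2,3,4,5,7,6,8,9]]),
   ([(0,1), (0,2), (0,3), (1,2), (1,3), (2,4), (3,5), (4,6), (4,7), (5,8), (6,8), (7,8)],
    Saturate 9 [
     Follow 21 [0,1,2,3,4,5,6,7,8,9]]),
   ([(0,1), (0,2), (0,3), (1,2), (1,3), (2,4), (3,5), (4,5), (4,6)],
    Saturate 5 [
     Follow 2 [0,1,2,3,4,5,6,7,8,9], Follow 0 [0,1,2,3,4,5,6,7,8,9],
     Follow 0 [0,1,2,3,4,5,6,8,7,9], Follow 0 [0,1,2,3,4,5,6,9,7,8]]),
   ([(0,1), (0,2), (0,3), (1,2), (1,3), (2,4), (3,5), (4,5), (4,6), (5,7)],
    Saturate 9 [
     Follow 0 [0,1,2,3,4,5,6,7,9,8]]),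
   ([(0,1), (0,2), (0,3), (1,2), (1,3), (2,4), (3,5), (4,5), (4,6), (5,7), (6,8), (7,8), (8,9)],
    Saturate 9 [
     Follow 9 [0,1,2,3,4,5,6,7,9,8]]),
   ([(0,1), (0,2), (0,3), (1,2), (1,3), (2,4), (3,5), (4,5), (4,6), (5,6)],
    Saturate 9 [
     Saturate 7 []]),
   ([(0,1), (0,2), (0,3), (1,2), (1,3), (2,4), (3,4), (4,5)],
    Saturate 8 [
     Follow 0 [0,1,2,3,4,5,8,6,7,9], Follow 0 [0,1,2,3,4,5,8,9,6,7],
     Follow 0 [0,1,2,3,4,5,8,9,7,6],
     Saturate 9 [
      Follow 0 [0,1,2,3,4,5,9,8,6,7], Follow 0 [0,1,2,3,4,5,9,8,7,6],
      Saturate 5 [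
       Follow 8 [0,1,2,3,4,5,6,7,8,9]]]]),
   ([(0,1), (0,2), (0,3), (1,2), (1,3), (2,4), (3,4), (4,5), (5,6), (6,7), (6,8)],
    Saturate 9 [
     Saturate 8 [
      Follow 7 [0,1,2,3,4,5,6,9,7,8]]]),
   ([(0,1), (0,2), (0,3), (1,2), (1,3), (2,3), (4,5), (4,6), (4,7)],
    Saturate 8 [
     Follow 2 [0,1,2,3,8,5,6,7,4,9], Follow 0 [0,1,2,3,8,5,6,9,4,7],
     Follow 0 [0,1,2,3,8,5,7,9,4,6], Follow 0 [0,1,2,3,8,6,7,9,4,5]]),
   ([(0,1), (0,2), (0,3), (1,2), (1,3), (2,3), (4,5), (4,6), (4,7), (5,8), (6,8), (8,9)],
    Saturate 7 [
     Follow 1 [0,1,2,3,5,8,7,4,6,9], Follow 0 [0,1,2,3,5,8,4,7,9,6],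
     Follow 0 [0,1,2,3,6,8,4,7,9,5]]),
   ([(0,1), (0,2), (0,3), (1,2), (1,3), (2,3), (4,5), (4,6), (4,7), (5,8), (5,9), (6,7), (6,9),
    (7,8)],
    Saturate 8 [
     Follow 1 [0,1,2,3,4,5,7,6,9,8]]),
   ([(0,1), (0,2), (0,3), (1,2), (1,3), (2,3), (4,5), (4,6), (4,7), (5,8), (6,8), (7,8)],
    Saturate 9 [
     Follow 4 [0,1,2,3,5,9,4,8,6,7]])]"

section \<open>Cubic graphs of order 10 are matching unique\<close>

lemma cubic_patterns_cubic: "list_all cubic_pattern cubic_patterns"
  by code_simp

lemma case_table_ok: "table_ok cubic_patterns case_table"
  by code_simp

lemma cubic_patterns_separated:
  "distinct (map (\<lambda>E. map (\<lambda>k. pattern_matchings k E) [4, 5]) cubic_patterns)"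
  by code_simp

lemma contains_cubic_pattern:
  assumes "cubic10 G"
  obtains E where "E \<in> set cubic_patterns" "cubic_pattern E" "contains_pattern G E"
proof -
  have "claw \<in> set (map fst case_table @ cubic_patterns)"
    by (simp add: case_table_def claw_def)
  from table_ok_sound[OF case_table_ok this contains_claw[OF assms] assms]
  obtain E where "E \<in> set cubic_patterns" "contains_pattern G E"
    by blast
  with cubic_patterns_cubic that show thesis
    by (auto simp: list_all_iff)
qed

lemma isomorphic_if_num_matchings_eq:
  assumes G: "cubic10 G" and H: "cubic10 H"
    and eq: "\<And>k. k \<le> 5 \<Longrightarrow> num_matchings H k = num_matchings G k"
  shows "graph_isomorphic H G"
proof -
  let ?\<rho> = "\<lambda>E. map (\<lambda>k. pattern_matchings k E) [4, 5]"
  obtain D where D: "D \<in> set cubic_patterns" "cubic_pattern D" "contains_pattern G D"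
    using contains_cubic_pattern[OF G] .
  obtain E where E: "E \<in> set cubic_patterns" "cubic_pattern E" "contains_pattern H E"
    using contains_cubic_pattern[OF H] .
  have "num_matchings G k = pattern_matchings k D" "num_matchings H k = pattern_matchings k E" for k
    using num_matchings_cubic_pattern D(2,3) E(2,3) G H by (auto simp: contains_pattern_def)
  then have "?\<rho> D = ?\<rho> E"
    using eq[of 4] eq[of 5] by simp
  moreover have "inj_on ?\<rho> (set cubic_patterns)"
    using cubic_patterns_separated by (simp only: distinct_map)
  ultimately have "D = E"
    using D(1) E(1) by (auto dest: inj_onD)
  then show ?thesis
    using isomorphic_if_same_cubic_pattern D E G H by blast
qed

theorem theorem2p4:
  fixes G :: "'a ugraph"
  assumes "simple_graph G"
    and "regular_graph 3 G"
    and "graph_order G = 10"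
  shows "matching_unique TYPE('b) G"
  unfolding matching_unique_def
proof (intro allI impI)
  fix H :: "'b ugraph"
  assume H: "simple_graph H" "matching_poly H = matching_poly G"
  have "regular_graph 3 H"
    using regular_graph_if_matching_poly_eq[OF assms(1,2) _ H] assms(3) by simp
  then have "cubic10 H"
    using H graph_order_eq[OF assms(1) H] assms(3) by (simp add: cubic10_def)
  moreover have "cubic10 G"
    using assms by (simp add: cubic10_def)
  moreover have "num_matchings H k = num_matchings G k" if "k \<le> 5" for k
    using num_matchings_eq[OF assms(1) H] assms(3) that by simp
  ultimately show "graph_isomorphic H G"
    by (intro isomorphic_if_num_matchings_eq)
qed

end
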